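(* Let $\mathbb{A}$ be a set of actions, let $\mathbb{A}^*$ be the set of all finite strings over $\mathbb{A}$ (including the empty string $\emptyset$), let $K$ be a positive integer, and let $f:\mathbb{A}^*\to\mathbb{R}_+$ satisfy $f(\emptyset)=0$. Let $O_K$ be an optimal strategy of length $K$ for maximizing $f(M)$ over $M\in\mathbb{A}^*$ with $|M|\le K$, let $G_K$ be a greedy strategy of length $K$, and let $\eta$ and $\sigma$ be, respectively, the total curvature and the forward curvature of $f$ from the greedy trajectory $G_K$. If $f$ is prefix-monotone, then $$\frac{f(G_K)}{f(O_K)}\ \ge\ \frac{1}{\eta}\left(1-\left(1-\eta\,\frac{1-\sigma}{K}\right)^K\right).$$
   Context: Strings: for $M=(a_1,\dots,a_m)$ and $N=(b_1,\dots,b_n)$ in $\mathbb{A}^*$, $(M,N)=(a_1,\dots,a_m,b_1,\dots,b_n)$ denotes concatenation and $|M|=m$ is the length. Write $M\preceq N$ ($M$ is a prefix of $N$) if $N=(M,L)$ for some $L\in\mathbb{A}^*$. For a string $M=(m_1,\dots,m_K)$ and $1\le i\le j\le K$, $M_{i:j}=(m_i,\dots,m_j)$; by convention $M_{i+1:i}=\emptyset$ and $G_{1:0}=\emptyset$. Prefix-monotone: $f(N)\ge f(M)$ for all $M\preceq N$ in $\mathbb{A}^*$ with $|N|\le K$. Optimal strategy: a string $O_K=(o_1,\dots,o_K)$ of length $K$ maximizing $f$ over all strings of length at most $K$. Greedy strategy: a string $G_K=G_{1:K}=(b_1,\dots,b_K)$ such that for all $i=1,\dots,K$, $b_i\in\operatorname{argmax}_{b\in\mathbb{A}}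 f((b_1,\dots,b_{i-1},b))$. Total curvature of $f$ from the greedy trajectory: $$\eta=\max_{\substack{M\in\mathbb{A}^*,\ |M|=K\\ 1\le i\le K-1}}\ \frac{K}{K-i}\left\{1-\frac{f((G_{1:i},M_{i+1:K}))-\frac{K-i}{K}f(M)}{f(G_{1:i})}\right\}.$$ Forward curvature of $f$ from the greedy trajectory: $$\sigma=\max_{\substack{0\le i\le K-1,\ i+1\le j\le K\\ M_{i+1:j}=(m_{i+1},\dots,m_j)\in\mathbb{A}^*}}\left\{1-\frac{f((G_{1:i},m_j))-f(G_{1:i})}{f((G_{1:i},M_{i+1:j}))-f((G_{1:i},M_{i+1:j-1}))}\right\}.$$ Well-definedness conventions: the maxima defining $\eta$ and $\sigma$ are taken over those choices for which the denominators are nonzero and are assumed to exist; the strategies $O_K,G_K$ are assumed to exist; $f(O_K)>0$ and $\eta\neq 0$, so that the displayed expressions make sense. *)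

theory Defs
  imports Complex_Main "HOL-Library.Sublist"
begin

text \<open>
  Strings over the action set \<open>A\<close> are the elements of \<open>lists A\<close>. For
  \<open>M = (m\<^sub>1, \<dots>, m\<^sub>K)\<close> the initial segment from \<open>1\<close> to \<open>i\<close> is \<open>take i M\<close>, and the segment
  from \<open>i + 1\<close> to \<open>K\<close> is \<open>drop i M\<close>; the \<open>i\<close>-th entry (counted from \<open>1\<close>) is \<open>M ! (i - 1)\<close>.
\<close>

definition prefix_monotone :: "'a set \<Rightarrow> nat \<Rightarrow> ('a list \<Rightarrow> real) \<Rightarrow> bool" where
  "prefix_monotone A K f \<longleftrightarrow>
     (\<forall>M\<in>lists A. \<forall>N\<in>lists A. prefix M N \<and> length N \<le> K \<longrightarrow> f N \<ge> f M)"

definition optimal_strategy :: "'a set \<Rightarrow> nat \<Rightarrow> ('a list \<Rightarrow> real) \<Rightarrow> 'a list \<Rightarrow> bool" where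
  "optimal_strategy A K f S \<longleftrightarrow>
     length S = K \<and> is_arg_max f (\<lambda>M. M \<in> lists A \<and> length M \<le> K) S"

definition greedy_strategy :: "'a set \<Rightarrow> nat \<Rightarrow> ('a list \<Rightarrow> real) \<Rightarrow> 'a list \<Rightarrow> bool" where
  "greedy_strategy A K f G \<longleftrightarrow>
     length G = K \<and> (\<forall>i<K. is_arg_max (\<lambda>b. f (take i G @ [b])) (\<lambda>b. b \<in> A) (G ! i))"

definition is_maximum :: "real set \<Rightarrow> real \<Rightarrow> bool" where
  "is_maximum X m \<longleftrightarrow> m \<in> X \<and> (\<forall>x\<in>X. x \<le> m)"

text \<open>
  The curvatures are maxima over the choices with nonzero denominator. They are given as
  relations, so that a curvature exists only if the maximum is attained; in particular there is
  no total curvature if no admissible choice exists (for instance if \<open>K = 1\<close>).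
\<close>

definition is_total_curvature ::
  "'a set \<Rightarrow> nat \<Rightarrow> ('a list \<Rightarrow> real) \<Rightarrow> 'a list \<Rightarrow> real \<Rightarrow> bool" where
  "is_total_curvature A K f G \<eta> \<longleftrightarrow>
     is_maximum
       {real K / (real K - real i) *
          (1 - (f (take i G @ drop i M) - (real K - real i) / real K * f M) / f (take i G)) | M i.
          M \<in> lists A \<and> length M = K \<and> 1 \<le> i \<and> i \<le> K - 1 \<and> f (take i G) \<noteq> 0}
       \<eta>"

text \<open>
  Below, \<open>L\<close> is the string of the entries \<open>m\<^sub>k\<close> with \<open>i + 1 \<le> k \<le> j\<close>. Thus \<open>last L\<close> is \<open>m\<^sub>j\<close>,
  and \<open>butlast L\<close> is the segment from \<open>i + 1\<close> to \<open>j - 1\<close>, which is empty if \<open>j = i + 1\<close>.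
\<close>

definition is_forward_curvature ::
  "'a set \<Rightarrow> nat \<Rightarrow> ('a list \<Rightarrow> real) \<Rightarrow> 'a list \<Rightarrow> real \<Rightarrow> bool" where
  "is_forward_curvature A K f G \<sigma> \<longleftrightarrow>
     is_maximum
       {1 - (f (take i G @ [last L]) - f (take i G)) /
            (f (take i G @ L) - f (take i G @ butlast L)) | i j L.
          i \<le> K - 1 \<and> i + 1 \<le> j \<and> j \<le> K \<and> L \<in> lists A \<and> length L = j - i \<and>
          f (take i G @ L) - f (take i G @ butlast L) \<noteq> 0}
       \<sigma>"

end

(* Write g(i) = f(G_{1:i}). By the forward curvature and the greedy choice, appending a string of
   length K - i to G_{1:i} gains at most (K - i) (g(i+1) - g(i)) / (1 - \<sigma>), while by the total
   curvature appending O_{i+1:K} gains at least (K - i)/K (f(O_K) - \<eta> g(i)). Hence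
   g(i+1) >= (1 - c \<eta>) g(i) + c f(O_K) with c = (1 - \<sigma>)/K. This recursion may be iterated
   because c \<eta> <= 1: evaluated at a maximizing choice, \<eta> is at most f(O_K) / g(1), and
   (1 - \<sigma>) f(O_K) <= K g(1). If some g(i) with i >= 1 vanishes, so that the total curvature says
   nothing about it, then g(1) = 0, which forces \<sigma> = 1. *)

theory Submission
  imports Defs
begin

section \<open>Elementary properties of monotone values, greedy and optimal strategies\<close>

lemma prefix_monotoneD:
  assumes "prefix_monotone A K f" "M @ L \<in> lists A" "length (M @ L) \<le> K"
  shows "f M \<le> f (M @ L)"
  using assms by (auto simp: prefix_monotone_def)

lemma greedy_strategy_in_lists:
  assumes "greedy_strategy A K f G"
  shows "G \<in> lists A"
proof -
  have "length G = K" and "\<forall>i<K. G ! i \<in> A"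
    using assms by (auto simp: greedy_strategy_def is_arg_max_def)
  then show ?thesis
    by (auto simp: in_set_conv_nth)
qed

lemma greedy_strategy_step:
  assumes "greedy_strategy A K f G" "i < K" "b \<in> A"
  shows "f (take i G @ [b]) \<le> f (take (Suc i) G)"
proof -
  have "length G = K" and "is_arg_max (\<lambda>b. f (take i G @ [b])) (\<lambda>b. b \<in> A) (G ! i)"
    using assms by (auto simp: greedy_strategy_def)
  then show ?thesis
    using assms(2,3) by (auto simp: is_arg_max_def take_Suc_conv_app_nth not_less)
qed

lemma optimal_strategyD:
  assumes "optimal_strategy A K f S"
  shows "length S = K" "S \<in> lists A" "\<And>M. M \<in> lists A \<Longrightarrow> length M \<le> K \<Longrightarrow> f M \<le> f S"
  using assms by (auto simp: optimal_strategy_def is_arg_max_def not_less)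

text \<open>The bound is the exact solution, starting from 0, of the recursion with equality, for
  which \<open>v / \<eta>\<close> is a fixed point. Comparing \<open>g\<close> with it by induction
  needs the slope \<open>1 - c * \<eta>\<close> to be nonnegative.\<close>

lemma affine_recursion_lower_bound:
  fixes g :: "nat \<Rightarrow> real"
  assumes "g 0 = 0" "\<eta> \<noteq> 0" "c * \<eta> \<le> 1"
    and step: "\<And>i. i < n \<Longrightarrow> (1 - c * \<eta>) * g i + c * v \<le> g (Suc i)"
  shows "v / \<eta> * (1 - (1 - c * \<eta>) ^ n) \<le> g n"
  using step
proof (induction n)
  case 0
  then show ?case using assms(1) by simp
next
  case (Suc n)
  have "v / \<eta> * (1 - (1 - c * \<eta>) ^ Suc n)
      = (1 - c * \<eta>) * (v / \<eta> * (1 - (1 - c * \<eta>) ^ n)) + c * v"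
    using assms(2) by (simp add: field_simps)
  also have "\<dots> \<le> (1 - c * \<eta>) * g n + c * v"
    using Suc assms(3) by (intro add_right_mono mult_left_mono) auto
  also have "\<dots> \<le> g (Suc n)"
    using Suc.prems by simp
  finally show ?case .
qed

section \<open>Monotonicity and curvature estimates along the greedy trajectory\<close>

context
  fixes A :: "'a set" and K :: nat and f :: "'a list \<Rightarrow> real" and G :: "'a list"
  assumes K_pos: "K > 0"
    and greedy: "greedy_strategy A K f G"
    and mono: "prefix_monotone A K f"
begin

lemma length_greedy: "length G = K"
  using greedy by (simp add: greedy_strategy_def)

lemma take_greedy_in_lists: "take i G \<in> lists A"
  using greedy_strategy_in_lists[OF greedy] by (auto dest: in_set_takeD)

lemma greedy_values_mono:
  assumes "i \<le> j"
  shows "f (take i G) \<le> f (take j G)"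
proof -
  have "take j G = take i G @ drop i (take j G)"
    using assms by (metis append_take_drop_id min.absorb1 take_take)
  then show ?thesis
    using prefix_monotoneD[OF mono, of "take i G" "drop i (take j G)"] take_greedy_in_lists[of j]
    by (simp add: length_greedy)
qed

text \<open>The maximum is attained, so \<open>\<sigma>\<close> is 1 minus an actual quotient, whose
  numerator and denominator are nonnegative by prefix-monotonicity. Inequalities may therefore be
  multiplied by \<open>1 - \<sigma>\<close>.\<close>

lemma forward_curvature_le_1:
  assumes "is_forward_curvature A K f G \<sigma>"
  shows "\<sigma> \<le> 1"
proof -
  obtain i j L where \<sigma>: "\<sigma> = 1 - (f (take i G @ [last L]) - f (take i G)) /
            (f (take i G @ L) - f (take i G @ butlast L))"
    and ij: "i \<le> K - 1" "i + 1 \<le> j" "j \<le> K" and L: "L \<in> lists A" "length L = j - i"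
    using assms by (auto simp: is_forward_curvature_def is_maximum_def)
  have ne: "L \<noteq> []" using ij L by auto
  then have app: "butlast L @ [last L] = L" by simp
  have last: "last L \<in> A" using L ne by auto
  have "f (take i G) \<le> f (take i G @ [last L])"
    using prefix_monotoneD[OF mono, of "take i G" "[last L]"] take_greedy_in_lists last K_pos ij
    by (simp add: length_greedy)
  moreover have "f (take i G @ butlast L) \<le> f (take i G @ L)"
    using prefix_monotoneD[OF mono, of "take i G @ butlast L" "[last L]"] app
      take_greedy_in_lists L ij by (simp add: length_greedy)
  ultimately show ?thesis using \<sigma> by simp
qed

text \<open>Up to the factor \<open>1 - \<sigma>\<close>, the late gain from \<open>b\<close> is at
  most the gain from placing \<open>b\<close> directly after \<open>take i G\<close>, and the greedy
  choice does at least as well as \<open>b\<close> there.\<close>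

lemma forward_curvature_increment:
  assumes \<sigma>: "is_forward_curvature A K f G \<sigma>"
    and L: "L @ [b] \<in> lists A" "length (L @ [b]) \<le> K - i"
  shows "(1 - \<sigma>) * (f (take i G @ L @ [b]) - f (take i G @ L))
           \<le> f (take (Suc i) G) - f (take i G)"
proof -
  let ?d = "f (take i G @ L @ [b]) - f (take i G @ L)"
  have i: "i < K" using L by auto
  have le: "f (take i G @ [b]) \<le> f (take (Suc i) G)"
    using greedy_strategy_step[OF greedy i] L by simp
  have d: "?d \<ge> 0"
    using prefix_monotoneD[OF mono, of "take i G @ L" "[b]"] take_greedy_in_lists L i
    by (simp add: length_greedy)
  show ?thesis
  proof (cases "?d = 0")
    case True
    \<comment> \<open>A zero increment is not among the choices for the maximum, but here it
      suffices that the greedy increment is nonnegative.\<close>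
    then show ?thesis using greedy_values_mono[of i "Suc i"] by simp
  next
    case False
    have "1 - (f (take i G @ [b]) - f (take i G)) / ?d \<in>
       {1 - (f (take i G @ [last L]) - f (take i G)) /
            (f (take i G @ L) - f (take i G @ butlast L)) | i j L.
          i \<le> K - 1 \<and> i + 1 \<le> j \<and> j \<le> K \<and> L \<in> lists A \<and> length L = j - i \<and>
          f (take i G @ L) - f (take i G @ butlast L) \<noteq> 0}"
      using False i L
      \<comment> \<open>The index \<open>j\<close> is chosen so that \<open>j - i\<close> is the
        length of \<open>L @ [b]\<close>; the length bound gives \<open>j \<le> K\<close>.\<close>
      by (intro CollectI exI[of _ i] exI[of _ "i + length (L @ [b])"] exI[of _ "L @ [b]"]) auto
    then have "1 - (f (take i G @ [b]) - f (take i G)) / ?d \<le> \<sigma>"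
      using \<sigma> by (simp only: is_forward_curvature_def is_maximum_def)
    then have "1 - \<sigma> \<le> (f (take i G @ [b]) - f (take i G)) / ?d" by simp
    then have "(1 - \<sigma>) * ?d \<le> f (take i G @ [b]) - f (take i G)"
      using d False by (simp add: pos_le_divide_eq)
    then show ?thesis using le by simp
  qed
qed

text \<open>Telescoping: the entries of \<open>L\<close> are appended one at a time, and each gain
  is controlled by the same greedy increment.\<close>

lemma forward_curvature_gain:
  assumes \<sigma>: "is_forward_curvature A K f G \<sigma>"
    and "L \<in> lists A" "length L \<le> K - i"
  shows "(1 - \<sigma>) * (f (take i G @ L) - f (take i G))
           \<le> real (length L) * (f (take (Suc i) G) - f (take i G))"
  using assms(2,3)
proof (induction L rule: rev_induct)
  case Nil
  then show ?case by simp
next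
  case (snoc b L)
  then show ?case
    using forward_curvature_increment[OF \<sigma> snoc.prems] by (simp add: algebra_simps)
qed

text \<open>This is the bound by \<open>\<eta>\<close> at the choice \<open>M\<close>,
  \<open>i\<close> with denominators cleared; both are positive, since \<open>i < K\<close> and the
  greedy value is positive.\<close>

lemma total_curvature_gain:
  assumes \<eta>: "is_total_curvature A K f G \<eta>"
    and M: "M \<in> lists A" "length M = K"
    and i: "1 \<le> i" "i \<le> K - 1"
    and pos: "f (take i G) > 0"
  shows "(K - i) / K * (f M - \<eta> * f (take i G)) \<le> f (take i G @ drop i M) - f (take i G)"
proof -
  define g r X where "g = f (take i G)" and "r = (real K - real i) / real K"
    and "X = f (take i G @ drop i M) - r * f M"
  have "real K / (real K - real i) * (1 - X / g) \<le> \<eta>"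
    using \<eta> M i pos unfolding is_total_curvature_def is_maximum_def g_def X_def r_def by fastforce
  moreover have "real K / (real K - real i) = 1 / r" by (simp add: r_def)
  ultimately have "(1 - X / g) / r \<le> \<eta>" by simp
  moreover have "r > 0" using i by (simp add: r_def)
  ultimately have "1 - X / g \<le> \<eta> * r" by (simp only: pos_divide_le_eq)
  moreover have "1 - X / g = (g - X) / g" using pos by (simp add: g_def diff_divide_distrib)
  ultimately have "g - X \<le> \<eta> * r * g" using pos by (simp only: pos_divide_le_eq g_def)
  then have "r * (f M - \<eta> * g) \<le> f (take i G @ drop i M) - g"
    by (simp add: X_def algebra_simps)
  then show ?thesis using i by (simp add: g_def r_def of_nat_diff)
qed

text \<open>An upper bound on \<open>\<eta>\<close> has to come from a choice attaining the maximum.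
  Its index \<open>i\<close> is unknown, so the bound is transferred to index 1 by monotonicity of
  the greedy values.\<close>

lemma total_curvature_le:
  assumes \<eta>: "is_total_curvature A K f G \<eta>"
    and bound: "\<And>M. M \<in> lists A \<Longrightarrow> length M = K \<Longrightarrow> f M \<le> v"
    and pos: "f (take 1 G) > 0" and "v \<ge> 0"
  shows "\<eta> * f (take 1 G) \<le> v"
proof -
  obtain M i where eq: "\<eta> = real K / (real K - real i) *
          (1 - (f (take i G @ drop i M) - (real K - real i) / real K * f M) / f (take i G))"
    and M: "M \<in> lists A" "length M = K" and i: "1 \<le> i" "i \<le> K - 1"
    using \<eta> by (auto simp: is_total_curvature_def is_maximum_def)
  let ?g = "f (take i G)" and ?r = "(real K - real i) / real K"
  have g: "f (take 1 G) \<le> ?g" using greedy_values_mono i by blast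
  with pos have gpos: "?g > 0" by linarith
  have r: "?r > 0" using i by simp
  have "drop i M \<in> lists A" using M(1) by (auto dest: in_set_dropD)
  then have "?g \<le> f (take i G @ drop i M)"
    using prefix_monotoneD[OF mono, of "take i G" "drop i M"] take_greedy_in_lists[of i] M i
    by (simp add: length_greedy)
  \<comment> \<open>Multiplying out the formula for \<open>\<eta>\<close> at the maximizing choice.
    Appending \<open>drop i M\<close> does not decrease \<open>f\<close>, so only
    \<open>?r * f M\<close> survives in the upper bound.\<close>
  have "\<eta> * ?r * ?g = ?g - (f (take i G @ drop i M) - ?r * f M)"
  proof -
    have "\<eta> = 1 / ?r * (1 - (f (take i G @ drop i M) - ?r * f M) / ?g)"
      unfolding eq by simp
    moreover have "\<And>r x :: real. r \<noteq> 0 \<Longrightarrow> 1 / r * (1 - x / ?g) * r * ?g = ?g - x"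
      using gpos by (simp add: field_simps)
    moreover have "?r \<noteq> 0" using r by linarith
    ultimately show ?thesis by (simp only: not_False_eq_True)
  qed
  also have "\<dots> \<le> ?r * f M" using \<open>?g \<le> f (take i G @ drop i M)\<close> by simp
  also have "\<dots> \<le> ?r * v" using bound[OF M] r by (intro mult_left_mono) auto
  finally have "?r * (\<eta> * ?g) \<le> ?r * v" by (simp only: ac_simps)
  then have "\<eta> * ?g \<le> v" using r by (simp only: mult_le_cancel_left_pos)
  show ?thesis
  \<comment> \<open>Replacing \<open>?g\<close> by the smaller first greedy value preserves the
    bound only for nonnegative \<open>\<eta>\<close>; for negative \<open>\<eta>\<close> the left
    side is at most 0.\<close>
  proof (cases "\<eta> \<ge> 0")
    case True
    then have "\<eta> * f (take 1 G) \<le> \<eta> * ?g" using g by (intro mult_left_mono)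
    with \<open>\<eta> * ?g \<le> v\<close> show ?thesis by linarith
  next
    case False
    then have "\<eta> * f (take 1 G) \<le> 0" using pos by (simp add: mult_nonpos_nonneg)
    with \<open>v \<ge> 0\<close> show ?thesis by linarith
  qed
qed

section \<open>Combination of the two curvatures\<close>

lemma forward_curvature_first_step:
  assumes "is_forward_curvature A K f G \<sigma>" "f [] = 0" "M \<in> lists A" "length M = K"
  shows "(1 - \<sigma>) * f M \<le> K * f (take 1 G)"
  \<comment> \<open>At index 0 the greedy prefix is empty and has value 0, so all of
    \<open>M\<close> counts as gain.\<close>
  using forward_curvature_gain[OF assms(1,3), of 0] assms by simp

lemma greedy_recursion:
  assumes \<eta>: "is_total_curvature A K f G \<eta>"
    and \<sigma>: "is_forward_curvature A K f G \<sigma>"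
    and f0: "f [] = 0"
    and M: "M \<in> lists A" "length M = K" "f M > 0"
    and i: "i < K"
  shows "(1 - \<sigma>) / K * (f M - \<eta> * f (take i G)) \<le> f (take (Suc i) G) - f (take i G)"
proof (cases "f (take 1 G) > 0")
  case True
  let ?g = "f (take i G)"
  have "(K - i) / K * (f M - \<eta> * ?g) \<le> f (take i G @ drop i M) - ?g"
  proof (cases "i = 0")
    case True
    \<comment> \<open>The total curvature starts at index 1; at index 0 both sides equal
      \<open>f M\<close>.\<close>
    then show ?thesis using f0 K_pos by simp
  next
    case False
    then have "?g > 0" using greedy_values_mono[of 1 i] True by simp
    then show ?thesis using total_curvature_gain[OF \<eta> M(1,2)] False i by simp
  qed
  then have "(1 - \<sigma>) * ((K - i) / K * (f M - \<eta> * ?g))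
      \<le> (1 - \<sigma>) * (f (take i G @ drop i M) - ?g)"
    using forward_curvature_le_1[OF \<sigma>] by (intro mult_left_mono) auto
  also have "\<dots> \<le> real (K - i) * (f (take (Suc i) G) - ?g)"
    using forward_curvature_gain[OF \<sigma>, of "drop i M" i] M by (auto dest: in_set_dropD)
  finally have "real (K - i) * ((1 - \<sigma>) / K * (f M - \<eta> * ?g))
      \<le> real (K - i) * (f (take (Suc i) G) - ?g)"
    by (simp add: mult_ac)
  \<comment> \<open>The remaining length \<open>K - i\<close> is positive and cancels, which leaves
    a coefficient independent of \<open>i\<close>.\<close>
  then show ?thesis using i by (subst (asm) mult_le_cancel_left_pos) auto
next
  case False
  have "real K * f (take 1 G) \<le> 0" using False by (simp add: mult_nonneg_nonpos)
  then have "(1 - \<sigma>) * f M \<le> 0"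
    using forward_curvature_first_step[OF \<sigma> f0 M(1,2)] by linarith
  then have "\<sigma> = 1"
    using forward_curvature_le_1[OF \<sigma>] M(3) by (simp add: mult_le_0_iff)
  \<comment> \<open>With \<open>\<sigma> = 1\<close> the left side is 0.\<close>
  then show ?thesis using greedy_values_mono[of i "Suc i"] by simp
qed

text \<open>For \<open>\<sigma> < 1\<close> the first-step bound makes the first greedy value
  positive. Chaining it with the bound on \<open>\<eta>\<close> through \<open>f S\<close> then
  allows this value to be cancelled.\<close>

lemma curvature_product_le_1:
  assumes \<eta>: "is_total_curvature A K f G \<eta>"
    and \<sigma>: "is_forward_curvature A K f G \<sigma>"
    and f0: "f [] = 0"
    and opt: "optimal_strategy A K f S"
    and pos: "f S > 0"
  shows "(1 - \<sigma>) / K * \<eta> \<le> 1"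
proof (cases "\<sigma> = 1")
  case False
  then have \<sigma>1: "1 - \<sigma> > 0" using forward_curvature_le_1[OF \<sigma>] by simp
  have first: "(1 - \<sigma>) * f S \<le> K * f (take 1 G)"
    using forward_curvature_first_step[OF \<sigma> f0] optimal_strategyD[OF opt] by simp
  have "0 < (1 - \<sigma>) * f S" using \<sigma>1 pos by simp
  then have "0 < real K * f (take 1 G)" using first by linarith
  then have g: "f (take 1 G) > 0" using K_pos by (simp add: zero_less_mult_iff)
  have "\<eta> * f (take 1 G) \<le> f S"
    using total_curvature_le[OF \<eta> _ g] optimal_strategyD[OF opt] pos by simp
  then have "(1 - \<sigma>) * (\<eta> * f (take 1 G)) \<le> (1 - \<sigma>) * f S"
    using \<sigma>1 by (intro mult_left_mono) auto
  then have "((1 - \<sigma>) * \<eta>) * f (take 1 G) \<le> K * f (take 1 G)"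
    using first by (simp only: mult.assoc)
  then have "(1 - \<sigma>) * \<eta> \<le> K" using g by (simp only: mult_le_cancel_right_pos)
  then show ?thesis using K_pos by (simp add: divide_le_eq)
qed simp

end

theorem theorem1:
  fixes A :: "'a set" and K :: nat and f :: "'a list \<Rightarrow> real"
    and OPT G :: "'a list" and \<eta> \<sigma> :: real
  assumes "K > 0"
    and "\<And>M. M \<in> lists A \<Longrightarrow> f M \<ge> 0"
    and "f [] = 0"
    and "optimal_strategy A K f OPT"
    and "greedy_strategy A K f G"
    and "is_total_curvature A K f G \<eta>"
    and "is_forward_curvature A K f G \<sigma>"
    and "f OPT > 0"
    and "\<eta> \<noteq> 0"
    and "prefix_monotone A K f"
  shows "f G / f OPT \<ge> 1 / \<eta> * (1 - (1 - \<eta> * ((1 - \<sigma>) / real K)) ^ K)"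
proof -
  let ?c = "(1 - \<sigma>) / K"
  note opt = optimal_strategyD[OF assms(4)]
  \<comment> \<open>The recursion is applied to the greedy values with \<open>v = f OPT\<close>; its
    initial value is \<open>f [] = 0\<close>.\<close>
  have "f OPT / \<eta> * (1 - (1 - ?c * \<eta>) ^ K) \<le> f (take K G)"
  proof (rule affine_recursion_lower_bound)
    show "?c * \<eta> \<le> 1"
      using curvature_product_le_1 assms by blast
    fix i assume "i < K"
    then have "?c * (f OPT - \<eta> * f (take i G)) \<le> f (take (Suc i) G) - f (take i G)"
      using greedy_recursion assms opt by blast
    then show "(1 - ?c * \<eta>) * f (take i G) + ?c * f OPT \<le> f (take (Suc i) G)"
      by (simp only: algebra_simps)
  qed (use assms in auto)
  also have "take K G = G"
    using assms(5) by (simp add: greedy_strategy_def)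
  finally have "1 / \<eta> * (1 - (1 - \<eta> * ?c) ^ K) * f OPT \<le> f G"
    by (simp add: mult_ac)
  then show ?thesis
    using assms(8) by (simp only: pos_le_divide_eq)
qed

end
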